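(* Let $M,C,K\in\mathbb{C}^{n\times n}$, $Q(\lambda)=\lambda^2M+\lambda C+K$, and let $\sigma$ be a given shift. Let $\mathcal{V}_k$ and $\mathcal{V}_{k+1}=\mathrm{span}\{V_k,v_{k+1}\}$ be consecutive projection subspaces computed by the subspace quadratic residual iteration method (described in the context) with shift $\sigma$, and let $(\lambda,x)$ be the desired eigenpair of $Q$. Put $x_\perp=(I-P_{V_k})x$ and suppose $\sin\angle(v_{k+1},x_\perp)\neq 0$. Then $$\sin\angle(\mathcal{V}_{k+1},x)=\sin\angle(\mathcal{V}_k,x)\,\sin\angle(v_{k+1},x_\perp).$$
   Context: Quadratic eigenvalue problem: $\lambda\in\mathbb{C}$ and $x\neq 0$ form an eigenpair of $Q$ if $Q(\lambda)x=(\lambda^2M+\lambda C+K)x=0$. For a given shift (target point) $\sigma$, the desired eigenpair $(\lambda,x)$ consists of the eigenvalue $\lambda$ closest to $\sigma$ and a corresponding eigenvector $x$. Notation: $\|\cdot\|$ is the 2-norm, $^*$ is the conjugate transpose. For a subspace $\mathcal{V}$ and a nonzero vector $x$, $\sin\angle(\mathcal{V},x)=\|(I-P_V)x\|/\|x\|$, where $P_V$ is the orthogonal projector onto $\mathcal{V}$. For nonzero vectors $v,w$, $\angle(v,w)\in[0,\pi/2]$ is the angle between $\mathrm{span}\{v\}$ and $w$. Subspace quadratic residual iteration method: Choose a shift $\sigma$ and an initial vector $v_1$ with $\|v_1\|=1$ and a convergence tolerance. For $k=1,2,\dots$: (i) set $V_k=[v_1,\dots,v_k]$, whose columns form an orthonormal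 basis of $\mathcal{V}_k$; (ii) project the quadratic eigenvalue problem onto $\mathcal{V}_k$, i.e. with $M_k=V_k^*MV_k$, $C_k=V_k^*CV_k$, $K_k=V_k^*KV_k$, solve $\omega^2M_kz+\omega C_kz+K_kz=0$ to obtain eigenvalues $\omega_i$ and eigenvectors $z_i$; (iii) form the Ritz vectors $\widetilde{x}_i=V_kz_i$ and residuals $r_i=\omega_i^2M\widetilde{x}_i+\omega_iC\widetilde{x}_i+K\widetilde{x}_i$; (iv) let $r$ be the first residual that has not converged (norm not below the tolerance); (v) compute $u=Q(\sigma)^{-1}r$ (normalized so that $\|u\|=1$); (vi) obtain the new vector $v_{k+1}=(I-P_{V_k})u$ (normalized when used as an orthonormal basis vector), and $\mathcal{V}_{k+1}=\mathrm{span}\{V_k,v_{k+1}\}$. *)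

theory Defs
  imports "HOL-Analysis.Analysis"
begin

subsection \<open>The quadratic eigenvalue problem\<close>

definition qep :: "complex^'n^'n \<Rightarrow> complex^'n^'n \<Rightarrow> complex^'n^'n \<Rightarrow> complex \<Rightarrow> complex^'n^'n"
  where "qep M C K l = (\<chi> i j. l\<^sup>2 * M $ i $ j + l * C $ i $ j + K $ i $ j)"

definition qep_eigenpair ::
    "complex^'n^'n \<Rightarrow> complex^'n^'n \<Rightarrow> complex^'n^'n \<Rightarrow> complex \<Rightarrow> complex^'n \<Rightarrow> bool"
  where "qep_eigenpair M C K l x \<longleftrightarrow> x \<noteq> 0 \<and> qep M C K l *v x = 0"

text \<open>The desired eigenvalue is one closest to the shift; a tie is not excluded.\<close>

definition desired_eigenpair ::
    "complex^'n^'n \<Rightarrow> complex^'n^'n \<Rightarrow> complex^'n^'n \<Rightarrow> complex \<Rightarrow> complex \<Rightarrow> complex^'n \<Rightarrow> bool"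
  where "desired_eigenpair M C K \<sigma> l x \<longleftrightarrow>
    qep_eigenpair M C K l x \<and>
    (\<forall>l' x'. qep_eigenpair M C K l' x' \<longrightarrow> dist l \<sigma> \<le> dist l' \<sigma>)"


subsection \<open>Orthogonal projectors and angles\<close>

text \<open>
  The library inner product on \<^typ>\<open>complex^'n\<close> is the real one, and \<^term>\<open>span\<close> is the real
  span.  Here the Hermitian form \<open>v\<^sup>* w\<close> and the complex span \<^term>\<open>vec.span\<close> are needed.
  The library \<^term>\<open>norm\<close> on \<^typ>\<open>complex^'n\<close> is the 2-norm.
\<close>

definition hinner :: "complex^'n \<Rightarrow> complex^'n \<Rightarrow> complex"
  where "hinner v w = (\<Sum>i\<in>UNIV. cnj (v $ i) * w $ i)"

text \<open>\<open>orth_proj V y\<close> is \<open>P\<^sub>V y\<close>; it is meant for complex subspaces \<open>V\<close>,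
  where the description is well defined.\<close>

definition orth_proj :: "(complex^'n) set \<Rightarrow> complex^'n \<Rightarrow> complex^'n"
  where "orth_proj V y = (THE p. p \<in> V \<and> (\<forall>w\<in>V. hinner w (y - p) = 0))"

lemma orth_proj_exists_unique:
  assumes "vec.subspace V"
  shows "\<exists>!p. p \<in> V \<and> (\<forall>w\<in>V. hinner w (y - p) = 0)"
proof -
  have R: "Re (hinner w z) = w \<bullet> z" for w z :: "complex^'n"
    by (simp add: hinner_def inner_vec_def inner_complex_def)
  have sc: "c *\<^sub>R w = complex_of_real c *s w" for c and w :: "complex^'n"
    by (simp add: vec_eq_iff complex_eq_iff)
  have sub: "subspace V"
    using assms by (auto simp: subspace_def vec.subspace_def sc)
  obtain p z where p: "p \<in> span V" "\<And>w. w \<in> span V \<Longrightarrow> orthogonal z w" "y = p + z"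
    using orthogonal_subspace_decomp_exists[of V y] by blast
  have pV: "span V = V" using sub by (simp add: span_eq_iff)
  have z: "hinner w z = 0" if "w \<in> V" for w
  proof -
    have "\<i> *s w \<in> V" using assms that by (simp add: vec.subspace_def)
    then have "w \<bullet> z = 0" "(\<i> *s w) \<bullet> z = 0"
      using p(2) that pV unfolding orthogonal_def by (metis inner_commute)+
    moreover have "hinner (\<i> *s w) z = - \<i> * hinner w z"
      by (simp add: hinner_def sum_distrib_left sum_negf mult.assoc)
    ultimately show ?thesis
      using R[of w z] R[of "\<i> *s w" z] by (auto simp: complex_eq_iff)
  qed
  show ?thesis
  proof (rule ex1I[of _ p])
    show "p \<in> V \<and> (\<forall>w\<in>V. hinner w (y - p) = 0)" using p pV z by auto
  next
    fix q assume q: "q \<in> V \<and> (\<forall>w\<in>V. hinner w (y - q) = 0)"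
    have "p - q \<in> V" using q p(1) pV sub by (simp add: subspace_diff)
    then have "(p - q) \<bullet> (y - q) = 0" "(p - q) \<bullet> z = 0" using q z R by (metis zero_complex.sel(1))+
    then have "(p - q) \<bullet> (p - q) = 0" using p(3) by (simp add: algebra_simps inner_diff_right inner_add_right)
    then show "q = p" by simp
  qed
qed

definition sin_angle :: "(complex^'n) set \<Rightarrow> complex^'n \<Rightarrow> real"
  where "sin_angle V x = norm (x - orth_proj V x) / norm x"

definition sin_angle_vec :: "complex^'n \<Rightarrow> complex^'n \<Rightarrow> real"
  where "sin_angle_vec v w = sin_angle (vec.span {v}) w"


subsection \<open>The subspace quadratic residual iteration method\<close>

text \<open>
  The basis vectors are \<open>v 1, v 2, \<dots>\<close>, and \<open>V\<^sub>k\<close> is the matrix with columns \<open>v 1, \<dots>, v k\<close>.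
  Since \<open>k\<close> varies during the iteration, the \<open>k \<times> k\<close> matrices and the vectors of length \<open>k\<close> are
  represented by functions on natural numbers whose indices are restricted to \<^term>\<open>{1..k::nat}\<close>.
\<close>

definition proj_space :: "(nat \<Rightarrow> complex^'n) \<Rightarrow> nat \<Rightarrow> (complex^'n) set"
  where "proj_space v k = vec.span (v ` {1..k})"

text \<open>\<open>proj_mat v A i j\<close> is the \<open>(i, j)\<close> entry of \<open>V\<^sub>k\<^sup>* A V\<^sub>k\<close>, for \<open>i, j \<le> k\<close>.\<close>

definition proj_mat :: "(nat \<Rightarrow> complex^'n) \<Rightarrow> complex^'n^'n \<Rightarrow> nat \<Rightarrow> nat \<Rightarrow> complex"
  where "proj_mat v A i j = hinner (v i) (A *v v j)"

definition proj_eigenpair ::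
    "complex^'n^'n \<Rightarrow> complex^'n^'n \<Rightarrow> complex^'n^'n \<Rightarrow> (nat \<Rightarrow> complex^'n) \<Rightarrow> nat \<Rightarrow>
     complex \<Rightarrow> (nat \<Rightarrow> complex) \<Rightarrow> bool"
  where "proj_eigenpair M C K v k \<omega> z \<longleftrightarrow>
    (\<exists>i\<in>{1..k}. z i \<noteq> 0) \<and>
    (\<forall>i\<in>{1..k}. \<omega>\<^sup>2 * (\<Sum>j=1..k. proj_mat v M i j * z j)
                  + \<omega> * (\<Sum>j=1..k. proj_mat v C i j * z j)
                  + (\<Sum>j=1..k. proj_mat v K i j * z j) = 0)"

text \<open>
  The solution of the projected problem is a list of pairs \<open>(\<omega>\<^sub>i, z\<^sub>i)\<close>, in an arbitrary order,
  in which every projected eigenvalue occurs, possibly several times.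
\<close>

definition proj_solution ::
    "complex^'n^'n \<Rightarrow> complex^'n^'n \<Rightarrow> complex^'n^'n \<Rightarrow> (nat \<Rightarrow> complex^'n) \<Rightarrow> nat \<Rightarrow>
     (complex \<times> (nat \<Rightarrow> complex)) list \<Rightarrow> bool"
  where "proj_solution M C K v k ps \<longleftrightarrow>
    (\<forall>(\<omega>, z)\<in>set ps. proj_eigenpair M C K v k \<omega> z) \<and>
    (\<forall>\<omega> z. proj_eigenpair M C K v k \<omega> z \<longrightarrow> \<omega> \<in> fst ` set ps)"

definition ritz_vector :: "(nat \<Rightarrow> complex^'n) \<Rightarrow> nat \<Rightarrow> (nat \<Rightarrow> complex) \<Rightarrow> complex^'n"
  where "ritz_vector v k z = (\<Sum>j=1..k. z j *s v j)"

definition ritz_residual ::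
    "complex^'n^'n \<Rightarrow> complex^'n^'n \<Rightarrow> complex^'n^'n \<Rightarrow> (nat \<Rightarrow> complex^'n) \<Rightarrow> nat \<Rightarrow>
     complex \<times> (nat \<Rightarrow> complex) \<Rightarrow> complex^'n"
  where "ritz_residual M C K v k = (\<lambda>(\<omega>, z). qep M C K \<omega> *v ritz_vector v k z)"

text \<open>
  One step from \<open>v 1, \<dots>, v k\<close> to \<open>v (Suc k)\<close>.  It is defined only if \<open>Q(\<sigma>)\<close> is invertible, some
  residual has not converged, and the new vector does not vanish.
\<close>

definition sqri_step ::
    "complex^'n^'n \<Rightarrow> complex^'n^'n \<Rightarrow> complex^'n^'n \<Rightarrow> complex \<Rightarrow> real \<Rightarrow>
     (nat \<Rightarrow> complex^'n) \<Rightarrow> nat \<Rightarrow> bool"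
  where "sqri_step M C K \<sigma> tol v k \<longleftrightarrow>
    invertible (qep M C K \<sigma>) \<and>
    (\<exists>ps r y u w.
       proj_solution M C K v k ps \<and>
       find (\<lambda>r. \<not> norm r < tol) (map (ritz_residual M C K v k) ps) = Some r \<and>
       y = matrix_inv (qep M C K \<sigma>) *v r \<and>
       u = y /\<^sub>R norm y \<and>
       w = u - orth_proj (proj_space v k) u \<and>
       w \<noteq> 0 \<and>
       v (Suc k) = w /\<^sub>R norm w)"

text \<open>\<open>sqri_run M C K \<sigma> tol v m\<close>: the method computes \<open>v 1, \<dots>, v m\<close>, hence the subspaces
  \<^term>\<open>proj_space v k\<close> with \<open>k \<le> m\<close>.\<close>

definition sqri_run ::
    "complex^'n^'n \<Rightarrow> complex^'n^'n \<Rightarrow> complex^'n^'n \<Rightarrow> complex \<Rightarrow> real \<Rightarrow>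
     (nat \<Rightarrow> complex^'n) \<Rightarrow> nat \<Rightarrow> bool"
  where "sqri_run M C K \<sigma> tol v m \<longleftrightarrow>
    norm (v 1) = 1 \<and> (\<forall>k\<in>{1..<m}. sqri_step M C K \<sigma> tol v k)"

end

theory Submission
  imports Defs
begin

text \<open>
  Since \<open>v\<^bsub>k+1\<^esub>\<close> is orthogonal to \<open>V\<^sub>k\<close>, projecting \<open>x\<close> onto \<open>V\<^bsub>k+1\<^esub>\<close> amounts to projecting \<open>x\<close>
  onto \<open>V\<^sub>k\<close> and the remainder \<open>x\<^sub>\<perp>\<close> onto \<open>v\<^bsub>k+1\<^esub>\<close>.  Hence the distance from \<open>x\<close> to \<open>V\<^bsub>k+1\<^esub>\<close>
  is that from \<open>x\<^sub>\<perp>\<close> to the line through \<open>v\<^bsub>k+1\<^esub>\<close>, and \<open>\<parallel>x\<^sub>\<perp>\<parallel>\<close> cancels from the product of sines.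
\<close>

lemma hinner_add_left: "hinner (u + v) w = hinner u w + hinner v w"
  by (simp add: hinner_def distrib_right sum.distrib)

lemma hinner_add_right: "hinner u (v + w) = hinner u v + hinner u w"
  by (simp add: hinner_def distrib_left sum.distrib)

lemma hinner_diff_right: "hinner u (v - w) = hinner u v - hinner u w"
  by (simp add: hinner_def right_diff_distrib sum_subtractf)

lemma hinner_scale_right: "hinner u (c *s w) = c * hinner u w"
  by (simp add: hinner_def sum_distrib_left algebra_simps)

lemma hinner_scaleR_right: "hinner u (c *\<^sub>R w) = c *\<^sub>R hinner u w"
  by (simp add: hinner_def scaleR_sum_right)

lemma orth_proj_eqI:
  assumes "vec.subspace V" "p \<in> V" "\<And>w. w \<in> V \<Longrightarrow> hinner w (y - p) = 0"
  shows "orth_proj V y = p"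
  unfolding orth_proj_def
  using orth_proj_exists_unique[OF assms(1)] assms(2,3) by (blast intro: the1_equality)

lemma
  assumes "vec.subspace V"
  shows orth_proj_in: "orth_proj V y \<in> V"
    and hinner_diff_orth_proj: "w \<in> V \<Longrightarrow> hinner w (y - orth_proj V y) = 0"
  using theI'[OF orth_proj_exists_unique[OF assms, of y]] by (auto simp: orth_proj_def)

text \<open>After both projections the remainder is orthogonal to \<open>W\<close> by the second
  one. It stays orthogonal to \<open>V\<close> because the second one subtracts only a vector of
  \<open>W\<close>.\<close>

lemma orth_proj_span_Un:
  assumes V: "vec.subspace V" and W: "vec.subspace W"
    and orth: "\<And>a b. a \<in> V \<Longrightarrow> b \<in> W \<Longrightarrow> hinner a b = 0"
  shows "orth_proj (vec.span (V \<union> W)) x = orth_proj V x + orth_proj W (x - orth_proj V x)"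
proof (rule orth_proj_eqI)
  let ?p = "orth_proj V x"
  let ?q = "orth_proj W (x - ?p)"
  have p: "?p \<in> V" and q: "?q \<in> W"
    by (simp_all add: V W orth_proj_in)
  show "?p + ?q \<in> vec.span (V \<union> W)"
    by (intro vec.span_add vec.span_base) (use p q in auto)
  fix w assume "w \<in> vec.span (V \<union> W)"
  then obtain a b where w: "w = a + b" and a: "a \<in> V" and b: "b \<in> W"
    using V W by (auto simp: vec.span_Un vec.span_eq_iff[THEN iffD2])
  have "hinner a (x - ?p) = 0" "hinner a ?q = 0" "hinner b (x - ?p - ?q) = 0"
    using a b q V W orth hinner_diff_orth_proj by blast+
  then show "hinner w (x - (?p + ?q)) = 0"
    by (simp add: w hinner_add_left hinner_add_right hinner_diff_right algebra_simps)
qed simp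

text \<open>Allows a subspace and its generators to be exchanged, both for the line through the new
  vector and for the growing projection space.\<close>

lemma vec_span_Un_span:
  fixes A B :: "('a::field^'n) set"
  shows "vec.span (A \<union> vec.span B) = vec.span (A \<union> B)"
  by (simp only: vec.span_Un vec.span_span)

lemma sin_angle_span_insert:
  assumes V: "vec.subspace V" and orth: "\<And>a. a \<in> V \<Longrightarrow> hinner a q = 0"
    and nz: "x \<notin> V"
  shows "sin_angle (vec.span (insert q V)) x =
    sin_angle V x * sin_angle_vec q (x - orth_proj V x)"
proof -
  have "vec.span (insert q V) = vec.span (V \<union> vec.span {q})"
    using vec_span_Un_span[of V "{q}"] by simp
  moreover have "hinner a b = 0" if "a \<in> V" "b \<in> vec.span {q}" for a b
    using that orth by (auto simp: vec.span_singleton hinner_scale_right)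
  ultimately have "orth_proj (vec.span (insert q V)) x
      = orth_proj V x + orth_proj (vec.span {q}) (x - orth_proj V x)"
    using orth_proj_span_Un[OF V vec.subspace_span] by metis
  \<comment> \<open>Its norm is the numerator of the first sine and the denominator of the second;
    being nonzero, it cancels.\<close>
  moreover have "x - orth_proj V x \<noteq> 0"
    using nz orth_proj_in[OF V, of x] by auto
  ultimately show ?thesis
    by (simp add: sin_angle_def sin_angle_vec_def diff_diff_eq)
qed

text \<open>The new vector is a real multiple of
  \<open>u - orth_proj (proj_space v k) u\<close>.\<close>

lemma sqri_step_orthogonal:
  assumes "sqri_step M C K \<sigma> tol v k" "a \<in> proj_space v k"
  shows "hinner a (v (Suc k)) = 0"
  using assms hinner_diff_orth_proj[of "proj_space v k"]
  by (auto simp: sqri_step_def proj_space_def hinner_scaleR_right)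

lemma proj_space_Suc: "proj_space v (Suc k) = vec.span (insert (v (Suc k)) (proj_space v k))"
proof -
  have "v ` {1..Suc k} = insert (v (Suc k)) (v ` {1..k})"
    by (simp add: atLeastAtMostSuc_conv)
  then show ?thesis
    unfolding proj_space_def using vec_span_Un_span[of "{v (Suc k)}" "v ` {1..k}"] by simp
qed

theorem theorem1:
  fixes M C K :: "complex^'n^'n"
    and \<sigma> l :: complex
    and tol :: real
    and v :: "nat \<Rightarrow> complex^'n"
    and k :: nat
    and x x_perp :: "complex^'n"
  assumes "1 \<le> k"
    and "sqri_run M C K \<sigma> tol v (Suc k)"
    and "desired_eigenpair M C K \<sigma> l x"
    and "x_perp = x - orth_proj (proj_space v k) x"
    and "sin_angle_vec (v (Suc k)) x_perp \<noteq> 0"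
  shows "sin_angle (proj_space v (Suc k)) x =
         sin_angle (proj_space v k) x * sin_angle_vec (v (Suc k)) x_perp"
proof -
  have sub: "vec.subspace (proj_space v k)"
    by (simp add: proj_space_def)
  have step: "sqri_step M C K \<sigma> tol v k"
    using assms(1,2) by (simp add: sqri_run_def)
  \<comment> \<open>Division by zero yields 0, so the sine with the zero vector is 0, which the
    assumption excludes.\<close>
  have "x_perp \<noteq> 0"
    using assms(5) by (auto simp: sin_angle_vec_def sin_angle_def)
  \<comment> \<open>A vector of the subspace is its own projection and would leave
    \<open>x_perp = 0\<close>.\<close>
  then have "x \<notin> proj_space v k"
    using orth_proj_eqI[OF sub, of x x] assms(4) by (auto simp: hinner_def)
  then show ?thesis
    unfolding proj_space_Suc assms(4)
    using sub sqri_step_orthogonal[OF step] by (intro sin_angle_span_insert) auto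
qed

end
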